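(* Let $\lambda\geqslant 1$ and let $\mathcal{B}$ be a basis of a Banach space $X$. Then $\mathcal{B}$ is $\lambda$-partially greedy if and only if it is quasi-greedy and $\lambda$-max conservative.
   Context: Let $(X,\|\cdot\|)$ be an infinite-dimensional Banach space over $\mathbb{K}=\mathbb{R}$ or $\mathbb{C}$ with dual $(X^*,\|\cdot\|_* )$. A basis of $X$ is a sequence $\mathcal{B}=(e_n)_{n=1}^\infty$ in $X$ such that: (1) there is a unique sequence $(e_n^* )_{n=1}^\infty$ in $X^*$ with $e_i^*(e_j)=\delta_{i,j}$ for all $i,j$; (2) $\sup_n\|e_n\|\|e_n^*\|_*<\infty$ and $0<\inf_n\|e_n\|\leqslant\sup_n\|e_n\|<\infty$; (3) $X$ is the norm-closed linear span of $\{e_n\}$; (4) $X^*$ is the weak$^*$-closed linear span of $\{e_n^*\}$. Notation: $\mathbb{N}_0=\mathbb{N}\cup\{0\}$; $\mathbb{N}^{<\infty}$ is the set of finite subsets of $\mathbb{N}$. For $A\in\mathbb{N}^{<\infty}$, $P_A(x)=\sum_{n\in A}e_n^*(x)e_n$ and $1_A=\sum_{n\in A}e_n$. $A<B$ means $a<b$ for all $a\in A,b\in B$; $\max\emptyset:=0$. $S_n(x)=\sum_{i=1}^n e_i^*(x)e_i$. A finite set $\Lambda\subset\mathbb{N}$ is a greedy set of $x\in X$ if $\min_{n\in\Lambda}|e_n^*(x)|\geqslant\max_{n\notin\Lambda}|e_n^*(x)|$ (the empty set is a greedy set of every $x$). For $m\in\mathbb{N}_0$, $\gamma_m(x)=\sup\{\|x-P_\Lambda(x)\|:\Lambda\text{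 is a greedy set of }x,\ |\Lambda|=m\}$ and $\widehat{\sigma}_m(x)=\inf\{\|x-S_n(x)\|:0\leqslant n\leqslant m\}$. $\mathcal{B}$ is quasi-greedy if there is $C\geqslant 1$ with $\gamma_m(x)\leqslant C\|x\|$ for all $x\in X$, $m\in\mathbb{N}_0$. $\mathcal{B}$ is $\lambda$-partially greedy if there is $C_\lambda\geqslant 1$ with $\gamma_{\lceil\lambda m\rceil}(x)\leqslant C_\lambda\widehat{\sigma}_m(x)$ for all $x\in X$, $m\in\mathbb{N}_0$. $\mathcal{B}$ is $\lambda$-max conservative if there is $C>0$ with $\|1_A\|\leqslant C\|1_B\|$ for all $A,B\in\mathbb{N}^{<\infty}$ with $A<B$ and $(\lambda-1)\max A+|A|\leqslant|B|$. *)

theory Defs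
  imports "HOL-Analysis.Analysis" "HOL-Library.Function_Algebras"
begin

text \<open>The scalar field: the real or the complex numbers with the usual absolute value, up to
  isometric isomorphism.\<close>

class real_or_complex = real_normed_field +
  assumes real_or_complex:
    "\<exists>\<phi> :: 'a \<Rightarrow> complex.
       (\<forall>x y. \<phi> (x + y) = \<phi> x + \<phi> y) \<and> (\<forall>x y. \<phi> (x * y) = \<phi> x * \<phi> y) \<and>
       (\<forall>r x. \<phi> (scaleR r x) = scaleR r (\<phi> x)) \<and> (\<forall>x. norm (\<phi> x) = norm x) \<and>
       (range \<phi> = \<real> \<or> range \<phi> = UNIV)"

instance real :: real_or_complex
  by standard (rule exI[of _ complex_of_real], auto simp: Reals_def scaleR_conv_of_real)

instance complex :: real_or_complex
  by standard (rule exI[of _ "\<lambda>z. z"], auto)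

text \<open>A Banach space over the scalar field. Its norm and its underlying real structure are those
  of the type class; compatibility with the latter loses no generality, since every Banach space
  is a real one by restriction of scalars.\<close>

locale banach_space_over = vector_space scaleK
  for scaleK :: "'k::real_or_complex \<Rightarrow> 'a::banach \<Rightarrow> 'a" +
  assumes norm_scale: "norm (scaleK c x) = norm c * norm x"
    and scale_of_real: "scaleK (of_real r) x = scaleR r x"

definition infinite_dimensional :: "('k::real_or_complex \<Rightarrow> 'a::banach \<Rightarrow> 'a) \<Rightarrow> bool" where
  "infinite_dimensional scaleK \<longleftrightarrow> \<not> (\<exists>S. finite S \<and> module.span scaleK S = UNIV)"

text \<open>The continuous dual; the dual norm is \<^const>\<open>onorm\<close>.\<close>

definition dual_space :: "('k::real_or_complex \<Rightarrow> 'a::banach \<Rightarrow> 'a) \<Rightarrow> ('a \<Rightarrow> 'k) set" where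
  "dual_space scaleK = {f. bounded_linear f \<and> (\<forall>c x. f (scaleK c x) = c * f x)}"

definition weak_star_topology ::
  "('k::real_or_complex \<Rightarrow> 'a::banach \<Rightarrow> 'a) \<Rightarrow> ('a \<Rightarrow> 'k) topology" where
  "weak_star_topology scaleK =
     subtopology (product_topology (\<lambda>_. euclidean) UNIV) (dual_space scaleK)"

text \<open>Sequences are indexed from 0: the term \<^term>\<open>e n\<close> stands for the basis vector with
  number \<open>n + 1\<close> in the usual numbering from 1, and a set of indices \<^term>\<open>A\<close> for the set
  \<^term>\<open>Suc ` A\<close> of such numbers.\<close>

definition biorthogonal ::
  "('k::real_or_complex \<Rightarrow> 'a::banach \<Rightarrow> 'a) \<Rightarrow> (nat \<Rightarrow> 'a) \<Rightarrow> (nat \<Rightarrow> 'a \<Rightarrow> 'k) \<Rightarrow> bool" where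
  "biorthogonal scaleK e es \<longleftrightarrow>
     (\<forall>n. es n \<in> dual_space scaleK) \<and> (\<forall>i j. es i (e j) = (if i = j then 1 else 0))"

definition coord ::
  "('k::real_or_complex \<Rightarrow> 'a::banach \<Rightarrow> 'a) \<Rightarrow> (nat \<Rightarrow> 'a) \<Rightarrow> nat \<Rightarrow> 'a \<Rightarrow> 'k" where
  "coord scaleK e = (THE es. biorthogonal scaleK e es)"

definition is_basis :: "('k::real_or_complex \<Rightarrow> 'a::banach \<Rightarrow> 'a) \<Rightarrow> (nat \<Rightarrow> 'a) \<Rightarrow> bool" where
  "is_basis scaleK e \<longleftrightarrow>
     (\<exists>!es. biorthogonal scaleK e es) \<and>
     bdd_above (range (\<lambda>n. norm (e n) * onorm (coord scaleK e n))) \<and>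
     0 < (INF n. norm (e n)) \<and> bdd_above (range (\<lambda>n. norm (e n))) \<and>
     closure (module.span scaleK (range e)) = UNIV \<and>
     weak_star_topology scaleK closure_of
       module.span (\<lambda>c f x. c * f x) (range (coord scaleK e)) = dual_space scaleK"

definition proj ::
  "('k::real_or_complex \<Rightarrow> 'a::banach \<Rightarrow> 'a) \<Rightarrow> (nat \<Rightarrow> 'a) \<Rightarrow> nat set \<Rightarrow> 'a \<Rightarrow> 'a" where
  "proj scaleK e A x = (\<Sum>n\<in>A. scaleK (coord scaleK e n x) (e n))"

definition partial_sum ::
  "('k::real_or_complex \<Rightarrow> 'a::banach \<Rightarrow> 'a) \<Rightarrow> (nat \<Rightarrow> 'a) \<Rightarrow> nat \<Rightarrow> 'a \<Rightarrow> 'a" where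
  "partial_sum scaleK e n x = (\<Sum>i<n. scaleK (coord scaleK e i x) (e i))"

definition greedy_set ::
  "('k::real_or_complex \<Rightarrow> 'a::banach \<Rightarrow> 'a) \<Rightarrow> (nat \<Rightarrow> 'a) \<Rightarrow> 'a \<Rightarrow> nat set \<Rightarrow> bool" where
  "greedy_set scaleK e x L \<longleftrightarrow>
     finite L \<and> (\<forall>n\<in>L. \<forall>k. k \<notin> L \<longrightarrow> norm (coord scaleK e n x) \<ge> norm (coord scaleK e k x))"

text \<open>Extended reals, so that the supremum is meaningful before it is known to be finite.\<close>

definition greedy_error ::
  "('k::real_or_complex \<Rightarrow> 'a::banach \<Rightarrow> 'a) \<Rightarrow> (nat \<Rightarrow> 'a) \<Rightarrow> nat \<Rightarrow> 'a \<Rightarrow> ereal" where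
  "greedy_error scaleK e m x =
     (SUP L\<in>{L. greedy_set scaleK e x L \<and> card L = m}. ereal (norm (x - proj scaleK e L x)))"

definition partial_sum_error ::
  "('k::real_or_complex \<Rightarrow> 'a::banach \<Rightarrow> 'a) \<Rightarrow> (nat \<Rightarrow> 'a) \<Rightarrow> nat \<Rightarrow> 'a \<Rightarrow> real" where
  "partial_sum_error scaleK e m x = (INF n\<in>{0..m}. norm (x - partial_sum scaleK e n x))"

definition quasi_greedy :: "('k::real_or_complex \<Rightarrow> 'a::banach \<Rightarrow> 'a) \<Rightarrow> (nat \<Rightarrow> 'a) \<Rightarrow> bool" where
  "quasi_greedy scaleK e \<longleftrightarrow>
     (\<exists>C::real. C \<ge> 1 \<and> (\<forall>x m. greedy_error scaleK e m x \<le> ereal (C * norm x)))"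

definition partially_greedy ::
  "real \<Rightarrow> ('k::real_or_complex \<Rightarrow> 'a::banach \<Rightarrow> 'a) \<Rightarrow> (nat \<Rightarrow> 'a) \<Rightarrow> bool" where
  "partially_greedy lam scaleK e \<longleftrightarrow>
     (\<exists>C::real. C \<ge> 1 \<and>
        (\<forall>x m. greedy_error scaleK e (nat \<lceil>lam * real m\<rceil>) x
                 \<le> ereal (C * partial_sum_error scaleK e m x)))"

text \<open>The largest number of a basis vector in \<^term>\<open>A\<close>, in the numbering from 1; it is 0 for the
  empty set.\<close>

definition max_number :: "nat set \<Rightarrow> nat" where
  "max_number A = Max (insert 0 (Suc ` A))"

definition max_conservative :: "real \<Rightarrow> (nat \<Rightarrow> 'a::banach) \<Rightarrow> bool" where
  "max_conservative lam e \<longleftrightarrow>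
     (\<exists>C::real. C > 0 \<and>
        (\<forall>A B. finite A \<and> finite B \<and> (\<forall>a\<in>A. \<forall>b\<in>B. a < b) \<and>
                (lam - 1) * real (max_number A) + real (card A) \<le> real (card B)
           \<longrightarrow> norm (\<Sum>n\<in>A. e n) \<le> C * norm (\<Sum>n\<in>B. e n)))"

end

theory Submission
  imports Defs
begin

text \<open>
  Write \<open>x\<^sub>n\<close> for the coordinates of \<open>x\<close>, \<open>[n]\<close> for the first \<open>n\<close> indices, and
  \<open>1\<^sub>A\<close> for the sum of the basis vectors with index in \<open>A\<close>.

  Suppose that the basis is partially greedy. Any greedy set can be trimmed, by dropping at
  most \<open>lam\<close> of its smallest coordinates, to a greedy set whose size is of the form
  \<open>\<lceil>lam m\<rceil>\<close>; the dropped terms are uniformly bounded by the norm of \<open>x\<close>, and the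
  partial sum with no terms shows that the error for the trimmed set is bounded too. This is
  quasi-greediness. For conservativity let \<open>m\<close> be the largest number in \<open>A\<close>. In the vector
  \<open>1\<^bsub>[m]\<^esub> + 1\<^bsub>B'\<^esub>\<close>, with a suitable part \<open>B'\<close> of \<open>B\<close>, all nonzero
  coordinates are equal, so the set \<open>([m] - A) \<union> B'\<close> is greedy and has error
  \<open>1\<^sub>A\<close>, while the partial sum of length \<open>m\<close> has error \<open>1\<^bsub>B'\<^esub>\<close>. The size
  condition on \<open>A\<close> and \<open>B\<close> is what makes a set \<open>B'\<close> of the right size available.

  Conversely, let \<open>L\<close> be greedy for \<open>x\<close> with \<open>\<lceil>lam m\<rceil>\<close> elements, let
  \<open>n \<le> m\<close>, and put \<open>y = x - S\<^sub>n x\<close>, \<open>A = [n] - L\<close>, \<open>B = L - [n]\<close>. Then the error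
  of \<open>L\<close> is \<open>(y - P\<^sub>B y) + P\<^sub>A x\<close>. The set \<open>B\<close> is greedy for \<open>y\<close>, so
  quasi-greediness controls the first summand. The coordinates of \<open>x\<close> on \<open>A\<close> are at most
  \<open>a = min\<^bsub>n\<in>B\<^esub> \<bar>x\<^sub>n\<bar>\<close>, and counting shows that \<open>A\<close> and \<open>B\<close> satisfy the size
  condition. Hence \<open>P\<^sub>A x\<close> is controlled by \<open>a\<close> times the norm of \<open>1\<^sub>B\<close>
  (\<open>norm_combination_le_max_conservative\<close>), which in turn is controlled by the norm of
  \<open>y\<close> for every quasi-greedy basis (\<open>norm_sum_basis_le_quasi_greedy\<close>).

  Both of the last two estimates rest on one convexity principle
  (\<open>norm_weighted_sum_le_upper_sets\<close>): a sum with weights in \<open>[0, 1]\<close> is a convex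
  combination of unweighted sums over sets on which the weights are largest.
\<close>

section \<open>Weighted sums and unweighted partial sums\<close>

text \<open>This is Abel summation in the form of a layer-cake decomposition. With \<open>x\<close> the index of
  least weight, the sum splits into \<open>w x - c\<close> times the full unweighted sum and a
  weighted sum over the remaining indices, now measured from the level \<open>w x\<close>; upper sets
  of the smaller index set are upper sets of the larger one because \<open>x\<close> is minimal. The lower
  level \<open>c\<close> is kept general to make this induction work.\<close>

lemma norm_weighted_sum_le_upper_sets:
  fixes f :: "'i \<Rightarrow> 'a::real_normed_vector" and w :: "'i \<Rightarrow> real"
  assumes "finite L" "\<And>n. n \<in> L \<Longrightarrow> c \<le> w n \<and> w n \<le> b" "c \<le> b"
    and "\<And>U. U \<subseteq> L \<Longrightarrow> (\<And>u v. u \<in> U \<Longrightarrow> v \<in> L - U \<Longrightarrow> w v \<le> w u) \<Longrightarrow> norm (sum f U) \<le> M"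
  shows "norm (\<Sum>n\<in>L. (w n - c) *\<^sub>R f n) \<le> (b - c) * M"
  using assms
proof (induction L arbitrary: c rule: finite_ranking_induct[where f = "\<lambda>n. - w n"])
  case empty
  from empty(3)[of "{}"] have "0 \<le> M" by simp
  with \<open>c \<le> b\<close> show ?case by simp
next
  case (insert x S)
  show ?case
  proof (cases "x \<in> S")
    case True
    then have S: "insert x S = S" by auto
    show ?thesis
      unfolding S by (rule insert.IH) (use insert.prems[unfolded S] in blast)+
  next
    case False
    have x: "c \<le> w x" "w x \<le> b" using insert.prems(1)[of x] by auto
    have "norm (\<Sum>n\<in>S. (w n - w x) *\<^sub>R f n) \<le> (b - w x) * M"
    proof (rule insert.IH)
      show "w x \<le> w n \<and> w n \<le> b" if "n \<in> S" for n
        using insert.hyps(2)[OF that] insert.prems(1)[of n] that by auto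
      show "norm (sum f U) \<le> M"
        if "U \<subseteq> S" "\<And>u v. u \<in> U \<Longrightarrow> v \<in> S - U \<Longrightarrow> w v \<le> w u" for U
        using that insert.hyps(2) by (intro insert.prems(3)) force+
    qed (use x in auto)
    moreover have "norm ((w x - c) *\<^sub>R sum f (insert x S)) \<le> (w x - c) * M"
      using x insert.prems(3)[of "insert x S"] by (simp add: mult_left_mono)
    ultimately have "norm ((w x - c) *\<^sub>R sum f (insert x S) + (\<Sum>n\<in>S. (w n - w x) *\<^sub>R f n))
        \<le> (w x - c) * M + (b - w x) * M"
      by (intro norm_triangle_mono)
    moreover have "(w x - c) *\<^sub>R sum f (insert x S) + (\<Sum>n\<in>S. (w n - w x) *\<^sub>R f n)
        = (\<Sum>n\<in>insert x S. (w n - c) *\<^sub>R f n)"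
      using False insert.hyps(1)
      by (simp add: scaleR_right_distrib scaleR_sum_right sum.distrib[symmetric]
          scaleR_left_distrib[symmetric])
    moreover have "(w x - c) * M + (b - w x) * M = (b - c) * M"
      by (simp add: algebra_simps)
    ultimately show ?thesis by (simp only:)
  qed
qed

lemma norm_real_combination_le_subset_sums:
  fixes f :: "'i \<Rightarrow> 'a::real_normed_vector" and r :: "'i \<Rightarrow> real"
  assumes "finite L" "\<And>n. n \<in> L \<Longrightarrow> \<bar>r n\<bar> \<le> a" "0 \<le> a"
    and "\<And>U. U \<subseteq> L \<Longrightarrow> norm (sum f U) \<le> M"
  shows "norm (\<Sum>n\<in>L. r n *\<^sub>R f n) \<le> 2 * a * M"
proof -
  have pos: "norm (\<Sum>n\<in>L. (max (s n) 0 - 0) *\<^sub>R f n) \<le> (a - 0) * M"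
    if "\<And>n. n \<in> L \<Longrightarrow> s n \<le> a" for s
    by (rule norm_weighted_sum_le_upper_sets) (use assms that in auto)
  have "(\<Sum>n\<in>L. r n *\<^sub>R f n)
      = (\<Sum>n\<in>L. (max (r n) 0 - 0) *\<^sub>R f n) - (\<Sum>n\<in>L. (max (- r n) 0 - 0) *\<^sub>R f n)"
    unfolding sum_subtractf[symmetric] by (rule sum.cong) (auto simp: max_def)
  moreover have "norm (\<Sum>n\<in>L. (max (r n) 0 - 0) *\<^sub>R f n) \<le> (a - 0) * M"
    by (rule pos) (use assms(2) in force)
  moreover have "norm (\<Sum>n\<in>L. (max (- r n) 0 - 0) *\<^sub>R f n) \<le> (a - 0) * M"
    by (rule pos) (use assms(2) in force)
  ultimately show ?thesis
    using norm_triangle_ineq4[of "\<Sum>n\<in>L. (max (r n) 0 - 0) *\<^sub>R f n"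
        "\<Sum>n\<in>L. (max (- r n) 0 - 0) *\<^sub>R f n"]
    by simp
qed

text \<open>Over the complex numbers \<open>\<iota>\<close> is the imaginary unit; over the reals it is 0.\<close>

lemma real_and_imaginary_parts:
  obtains \<iota> :: "'k::real_or_complex" where "norm \<iota> \<le> 1"
    "\<And>a. \<exists>r s. a = of_real r + of_real s * \<iota> \<and> \<bar>r\<bar> \<le> norm a \<and> \<bar>s\<bar> \<le> norm a"
proof -
  obtain \<phi> :: "'k \<Rightarrow> complex" where add: "\<And>x y. \<phi> (x + y) = \<phi> x + \<phi> y"
    and mult: "\<And>x y. \<phi> (x * y) = \<phi> x * \<phi> y" and scale: "\<And>r x. \<phi> (r *\<^sub>R x) = r *\<^sub>R \<phi> x"
    and norm: "\<And>x. norm (\<phi> x) = norm x" and range: "range \<phi> = \<real> \<or> range \<phi> = UNIV"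
    using real_or_complex[where 'a = 'k] by metis
  have inj: "x = y" if "\<phi> x = \<phi> y" for x y
  proof -
    have "\<phi> (x - y) + \<phi> y = \<phi> x" by (simp flip: add)
    with that have "\<phi> (x - y) = 0" by simp
    with norm[of "x - y"] show ?thesis by simp
  qed
  have "\<phi> 1 \<noteq> 0" using norm[of 1] by auto
  with mult[of 1 1] have "\<phi> 1 = 1" by simp
  then have of_real: "\<phi> (of_real r) = of_real r" for r
    by (simp add: of_real_def scale)
  from range show ?thesis
  proof
    assume R: "range \<phi> = \<real>"
    show ?thesis
    proof (rule that[of 0])
      fix a
      from R have "\<phi> a \<in> \<real>" by auto
      then obtain r where "\<phi> a = of_real r" by (auto elim: Reals_cases)
      then show "\<exists>r s. a = of_real r + of_real s * 0 \<and> \<bar>r\<bar> \<le> norm a \<and> \<bar>s\<bar> \<le> norm a"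
        using inj[of a "of_real r"] by (intro exI[of _ r] exI[of _ 0]) (auto simp: of_real)
    qed simp
  next
    assume "range \<phi> = UNIV"
    then obtain \<iota> where \<iota>: "\<phi> \<iota> = \<i>" by (metis surjD)
    show ?thesis
    proof (rule that[of \<iota>])
      show "norm \<iota> \<le> 1" using norm[of \<iota>] \<iota> by simp
    next
      fix a
      have "a = of_real (Re (\<phi> a)) + of_real (Im (\<phi> a)) * \<iota>"
        by (rule inj) (simp add: add mult of_real \<iota> complex_eq mult.commute)
      moreover have "\<bar>Re (\<phi> a)\<bar> \<le> norm a" "\<bar>Im (\<phi> a)\<bar> \<le> norm a"
        using abs_Re_le_cmod[of "\<phi> a"] abs_Im_le_cmod[of "\<phi> a"] by (simp_all add: norm)
      ultimately show "\<exists>r s. a = of_real r + of_real s * \<iota> \<and> \<bar>r\<bar> \<le> norm a \<and> \<bar>s\<bar> \<le> norm a"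
        by blast
    qed
  qed
qed

lemma (in banach_space_over) norm_combination_le_subset_sums:
  assumes "finite L" "\<And>n. n \<in> L \<Longrightarrow> norm (c n) \<le> a" "0 \<le> a"
    and "\<And>U. U \<subseteq> L \<Longrightarrow> norm (sum f U) \<le> M"
  shows "norm (\<Sum>n\<in>L. scaleK (c n) (f n)) \<le> 4 * a * M"
proof -
  obtain \<iota> :: 'k where \<iota>: "norm \<iota> \<le> 1"
    and parts: "\<And>a. \<exists>r s. a = of_real r + of_real s * \<iota> \<and> \<bar>r\<bar> \<le> norm a \<and> \<bar>s\<bar> \<le> norm a"
    using real_and_imaginary_parts by blast
  from parts have "\<forall>a. \<exists>r s. a = of_real r + of_real s * \<iota> \<and> \<bar>r\<bar> \<le> norm a \<and> \<bar>s\<bar> \<le> norm a"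
    by blast
  then obtain r s where rs: "\<And>a. a = of_real (r a) + of_real (s a) * \<iota>"
    "\<And>a. \<bar>r a\<bar> \<le> norm a" "\<And>a. \<bar>s a\<bar> \<le> norm a" by metis
  have rs_le: "\<bar>r (c n)\<bar> \<le> a" "\<bar>s (c n)\<bar> \<le> a" if "n \<in> L" for n
    using assms(2)[OF that] rs(2,3)[of "c n"] by linarith+
  have R: "norm (\<Sum>n\<in>L. r (c n) *\<^sub>R f n) \<le> 2 * a * M"
    and S: "norm (\<Sum>n\<in>L. s (c n) *\<^sub>R f n) \<le> 2 * a * M"
    by (rule norm_real_combination_le_subset_sums; use assms rs_le in blast)+
  have "scaleK (c n) (f n) = r (c n) *\<^sub>R f n + scaleK \<iota> (s (c n) *\<^sub>R f n)" for n
  proof -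
    have "scaleK (c n) (f n) = scaleK (of_real (r (c n)) + of_real (s (c n)) * \<iota>) (f n)"
      by (rule arg_cong[OF rs(1)])
    also have "\<dots> = r (c n) *\<^sub>R f n + scaleK \<iota> (s (c n) *\<^sub>R f n)"
      by (simp add: scale_left_distrib scale_of_real[symmetric] mult.commute)
    finally show ?thesis .
  qed
  then have "(\<Sum>n\<in>L. scaleK (c n) (f n))
      = (\<Sum>n\<in>L. r (c n) *\<^sub>R f n) + scaleK \<iota> (\<Sum>n\<in>L. s (c n) *\<^sub>R f n)"
    by (simp add: sum.distrib scale_sum_right)
  then have "norm (\<Sum>n\<in>L. scaleK (c n) (f n))
      \<le> norm (\<Sum>n\<in>L. r (c n) *\<^sub>R f n) + norm \<iota> * norm (\<Sum>n\<in>L. s (c n) *\<^sub>R f n)"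
    by (metis norm_triangle_ineq norm_scale)
  also have "\<dots> \<le> 2 * a * M + 1 * (2 * a * M)"
    using R S \<iota> by (intro add_mono mult_mono) auto
  finally show ?thesis by (simp add: mult_ac)
qed

section \<open>Coordinates and greedy sets\<close>

locale banach_basis = banach_space_over scaleK
  for scaleK :: "'k::real_or_complex \<Rightarrow> 'a::banach \<Rightarrow> 'a" +
  fixes e :: "nat \<Rightarrow> 'a"
  assumes basis: "is_basis scaleK e"
begin

abbreviation "co \<equiv> coord scaleK e"
abbreviation "P \<equiv> proj scaleK e"
abbreviation "greedy \<equiv> greedy_set scaleK e"

lemma biorthogonal_coord: "biorthogonal scaleK e co"
proof -
  have "\<exists>!es. biorthogonal scaleK e es" using basis by (simp add: is_basis_def)
  then show ?thesis unfolding coord_def by (rule theI')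
qed

lemma bounded_linear_coord: "bounded_linear (co n)"
  using biorthogonal_coord by (auto simp: biorthogonal_def dual_space_def)

lemma coord_scale: "co n (scaleK c x) = c * co n x"
  using biorthogonal_coord by (auto simp: biorthogonal_def dual_space_def)

lemma coord_basis: "co n (e j) = (if n = j then 1 else 0)"
  using biorthogonal_coord by (auto simp: biorthogonal_def)

lemma coord_combination:
  assumes "finite B"
  shows "co n (\<Sum>j\<in>B. scaleK (c j) (e j)) = (if n \<in> B then c n else 0)"
proof -
  interpret bounded_linear "co n" by (rule bounded_linear_coord)
  have "co n (\<Sum>j\<in>B. scaleK (c j) (e j)) = (\<Sum>j\<in>B. if n = j then c j else 0)"
    unfolding sum coord_scale coord_basis by (rule sum.cong) auto
  also have "\<dots> = (if n \<in> B then c n else 0)" using assms by simp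
  finally show ?thesis .
qed

lemma coord_sum_basis:
  assumes "finite B"
  shows "co n (\<Sum>j\<in>B. e j) = (if n \<in> B then 1 else 0)"
  using coord_combination[OF assms, of n "\<lambda>_. 1"] by simp

lemma coord_diff_proj:
  assumes "finite B"
  shows "co n (x - P B x) = (if n \<in> B then 0 else co n x)"
  using coord_combination[OF assms, of n "\<lambda>j. co j x"]
  by (simp add: proj_def bounded_linear.linear[OF bounded_linear_coord] linear_diff)

lemma partial_sum_eq_proj: "partial_sum scaleK e n x = P {..<n} x"
  by (simp add: partial_sum_def proj_def)

lemma proj_cong: "(\<And>n. n \<in> B \<Longrightarrow> co n x = co n y) \<Longrightarrow> P B x = P B y"
  by (simp add: proj_def)

lemma proj_sum_basis:
  assumes "finite B" "U \<subseteq> B"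
  shows "P U (\<Sum>n\<in>B. e n) = (\<Sum>n\<in>U. e n)"
  unfolding proj_def using assms by (intro sum.cong) (auto simp: coord_sum_basis)

lemma proj_diff:
  assumes "finite B" "U \<subseteq> B"
  shows "P (B - U) x = P B x - P U x"
  using assms by (simp add: proj_def sum_diff)

text \<open>Each single term is bounded because the norms of the basis vectors times those of their
  coordinate functionals are. The growth of the bound with the number of terms is harmless where that number is bounded.\<close>

lemma norm_proj_le_card:
  obtains K where "0 \<le> K" "\<And>A x. finite A \<Longrightarrow> norm (P A x) \<le> card A * (K * norm x)"
proof -
  obtain K where K: "\<And>n. norm (e n) * onorm (co n) \<le> K"
    using basis by (auto simp: is_basis_def bdd_above_def)
  have "0 \<le> norm (e 0) * onorm (co 0)"
    using onorm_pos_le[OF bounded_linear_coord] by simp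
  with K[of 0] have "0 \<le> K" by linarith
  moreover have "norm (P A x) \<le> card A * (K * norm x)" if "finite A" for A x
    unfolding proj_def
  proof (rule sum_norm_bound)
    fix n
    have "norm (scaleK (co n x) (e n)) = norm (co n x) * norm (e n)" by (simp add: norm_scale)
    also have "\<dots> \<le> (onorm (co n) * norm x) * norm (e n)"
      by (intro mult_right_mono onorm bounded_linear_coord) simp
    also have "\<dots> = (norm (e n) * onorm (co n)) * norm x" by simp
    also have "\<dots> \<le> K * norm x" using K by (intro mult_right_mono) auto
    finally show "norm (scaleK (co n x) (e n)) \<le> K * norm x" .
  qed
  ultimately show ?thesis using that by blast
qed

text \<open>Dropping an index with the smallest coordinate keeps a greedy set greedy.\<close>

lemma greedy_subset_of_card:
  assumes "greedy x L" "k \<le> card L"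
  obtains L' where "L' \<subseteq> L" "greedy x L'" "card L' = k"
proof -
  have "\<exists>L'\<subseteq>L. greedy x L' \<and> card L' = k"
    using assms
  proof (induction "card L - k" arbitrary: L)
    case 0
    then show ?case by auto
  next
    case (Suc d)
    then have L: "finite L" "L \<noteq> {}" by (auto simp: greedy_set_def)
    obtain i where i: "i \<in> L" "\<And>n. n \<in> L \<Longrightarrow> norm (co i x) \<le> norm (co n x)"
      using ex_is_arg_min_if_finite[OF L, of "\<lambda>n. norm (co n x)"]
      by (auto simp: is_arg_min_linorder)
    have "greedy x (L - {i})"
      using Suc.prems(1) i unfolding greedy_set_def by auto
    moreover have "card (L - {i}) = card L - 1" using i L by simp
    ultimately obtain L' where "L' \<subseteq> L - {i}" "greedy x L'" "card L' = k"
      using Suc.hyps(1)[of "L - {i}"] Suc.hyps(2) by force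
    then show ?case by blast
  qed
  then show ?thesis using that by blast
qed

lemma quasi_greedy_iff:
  "quasi_greedy scaleK e
    \<longleftrightarrow> (\<exists>C\<ge>1. \<forall>x L. greedy x L \<longrightarrow> norm (x - P L x) \<le> C * norm x)"
  by (auto simp: quasi_greedy_def greedy_error_def SUP_le_iff)

lemma partially_greedy_iff:
  "partially_greedy lam scaleK e
    \<longleftrightarrow> (\<exists>C\<ge>1. \<forall>x m n L. n \<le> m \<and> greedy x L \<and> card L = nat \<lceil>lam * real m\<rceil>
          \<longrightarrow> norm (x - P L x) \<le> C * norm (x - P {..<n} x))"
proof -
  have *: "t \<le> C * partial_sum_error scaleK e m x
      \<longleftrightarrow> (\<forall>n\<le>m. t \<le> C * norm (x - P {..<n} x))" if "C \<ge> 1" for t C m x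
  proof -
    have "t \<le> C * partial_sum_error scaleK e m x \<longleftrightarrow> t / C \<le> partial_sum_error scaleK e m x"
      using that by (simp add: field_simps)
    also have "\<dots> \<longleftrightarrow> (\<forall>n\<in>{0..m}. t / C \<le> norm (x - P {..<n} x))"
      unfolding partial_sum_error_def partial_sum_eq_proj
      by (rule le_cINF_iff) auto
    also have "\<dots> \<longleftrightarrow> (\<forall>n\<le>m. t \<le> C * norm (x - P {..<n} x))"
      using that by (auto simp: field_simps)
    finally show ?thesis .
  qed
  show ?thesis
    unfolding partially_greedy_def greedy_error_def SUP_le_iff ereal_less_eq
    by (rule ex_cong1, rule conj_cong) (auto simp: *)
qed

section \<open>Estimates for quasi-greedy and max-conservative bases\<close>

text \<open>All nonzero coordinates of a sum of basis vectors with coefficients of modulus 1 are equal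
  in size, so every subset of \<open>B\<close> is greedy, and every part of the sum has norm at most \<open>C\<close>
  times that of the whole; the convexity principle then removes the signs.\<close>

lemma norm_sum_basis_le_signed_sum:
  assumes qg: "\<And>x L. greedy x L \<Longrightarrow> norm (x - P L x) \<le> C * norm x"
    and B: "finite B" and \<epsilon>: "\<And>n. n \<in> B \<Longrightarrow> norm (\<epsilon> n) = 1"
  shows "norm (\<Sum>n\<in>B. e n) \<le> 4 * C * norm (\<Sum>n\<in>B. scaleK (\<epsilon> n) (e n))"
proof -
  define z where "z = (\<Sum>n\<in>B. scaleK (\<epsilon> n) (e n))"
  have co_z: "co n z = (if n \<in> B then \<epsilon> n else 0)" for n
    unfolding z_def by (rule coord_combination[OF B])
  have part: "norm (\<Sum>n\<in>U. scaleK (\<epsilon> n) (e n)) \<le> C * norm z" if U: "U \<subseteq> B" for U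
  proof -
    have "greedy z (B - U)"
      using B \<epsilon> by (auto simp: greedy_set_def co_z)
    moreover have "P V z = (\<Sum>n\<in>V. scaleK (\<epsilon> n) (e n))" if "V \<subseteq> B" for V
      unfolding proj_def using that by (intro sum.cong) (auto simp: co_z)
    then have "z - P (B - U) z = (\<Sum>n\<in>U. scaleK (\<epsilon> n) (e n))"
      using U by (simp add: proj_diff[OF B U] z_def)
    ultimately show ?thesis using qg by metis
  qed
  have "norm (\<Sum>n\<in>B. scaleK (inverse (\<epsilon> n)) (scaleK (\<epsilon> n) (e n))) \<le> 4 * 1 * (C * norm z)"
    by (rule norm_combination_le_subset_sums) (use B \<epsilon> part in \<open>auto simp: norm_inverse\<close>)
  moreover have "(\<Sum>n\<in>B. scaleK (inverse (\<epsilon> n)) (scaleK (\<epsilon> n) (e n))) = (\<Sum>n\<in>B. e n)"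
  proof (rule sum.cong[OF refl])
    fix n assume "n \<in> B"
    then have "\<epsilon> n \<noteq> 0" using \<epsilon> by force
    then show "scaleK (inverse (\<epsilon> n)) (scaleK (\<epsilon> n) (e n)) = e n" by simp
  qed
  ultimately show ?thesis by (simp add: z_def)
qed

text \<open>Flattening the coordinates \<open>y\<^sub>n\<close> on \<open>B\<close> to size \<open>a\<close> multiplies them by the
  weights \<open>a / \<bar>y\<^sub>n\<bar> \<le> 1\<close>. A set of indices where these weights are largest is the complement
  in \<open>B\<close> of a greedy set of \<open>y\<close>, so the corresponding part of \<open>y\<close> is a difference
  of two greedy projections.\<close>

lemma norm_sum_basis_le_quasi_greedy:
  assumes qg: "\<And>x L. greedy x L \<Longrightarrow> norm (x - P L x) \<le> C * norm x" and "C \<ge> 0"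
    and B: "greedy y B" and a: "0 \<le> a" "\<And>n. n \<in> B \<Longrightarrow> a \<le> norm (co n y)"
  shows "a * norm (\<Sum>n\<in>B. e n) \<le> 8 * C ^ 2 * norm y"
proof (cases "a = 0")
  case True
  then show ?thesis by simp
next
  case False
  with a have "a > 0" by simp
  have fin: "finite B" using B by (simp add: greedy_set_def)
  have nz: "co n y \<noteq> 0" if "n \<in> B" for n using a(2)[OF that] \<open>a > 0\<close> by auto
  define \<epsilon> where "\<epsilon> n = co n y / of_real (norm (co n y))" for n
  let ?f = "\<lambda>n. scaleK (co n y) (e n)" and ?w = "\<lambda>n. a / norm (co n y)"
  have "norm (\<Sum>n\<in>B. (?w n - 0) *\<^sub>R ?f n) \<le> (1 - 0) * (2 * C * norm y)"
  proof (rule norm_weighted_sum_le_upper_sets)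
    fix U assume U: "U \<subseteq> B" "\<And>u v. u \<in> U \<Longrightarrow> v \<in> B - U \<Longrightarrow> ?w v \<le> ?w u"
    have "norm (co u y) \<le> norm (co v y)" if "u \<in> U" "v \<in> B - U" for u v
    proof -
      have "co u y \<noteq> 0" "co v y \<noteq> 0" using U(1) that nz by auto
      with U(2)[OF that] \<open>a > 0\<close> show ?thesis by (simp add: field_simps)
    qed
    then have "greedy y (B - U)"
      using B unfolding greedy_set_def by blast
    then have "norm (y - P (B - U) y) \<le> C * norm y" "norm (y - P B y) \<le> C * norm y"
      using qg B by auto
    moreover have "sum ?f U = (y - P (B - U) y) - (y - P B y)"
      using proj_diff[OF fin U(1), of y] by (simp add: proj_def)
    ultimately show "norm (sum ?f U) \<le> 2 * C * norm y"
      using norm_triangle_ineq4[of "y - P (B - U) y" "y - P B y"] by simp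
  qed (use fin a nz in auto)
  moreover have "(\<Sum>n\<in>B. (?w n - 0) *\<^sub>R ?f n) = a *\<^sub>R (\<Sum>n\<in>B. scaleK (\<epsilon> n) (e n))"
    unfolding scaleR_sum_right
    by (rule sum.cong)
      (simp_all add: \<epsilon>_def scale_of_real[symmetric] divide_inverse mult_ac)
  ultimately have flat: "a * norm (\<Sum>n\<in>B. scaleK (\<epsilon> n) (e n)) \<le> 2 * C * norm y"
    using a by simp
  have "norm (\<Sum>n\<in>B. e n) \<le> 4 * C * norm (\<Sum>n\<in>B. scaleK (\<epsilon> n) (e n))"
    by (rule norm_sum_basis_le_signed_sum[OF qg fin]) (auto simp: \<epsilon>_def norm_divide nz)
  then have "a * norm (\<Sum>n\<in>B. e n) \<le> 4 * C * (a * norm (\<Sum>n\<in>B. scaleK (\<epsilon> n) (e n)))"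
    using a by (simp add: mult_left_mono mult.left_commute)
  also have "\<dots> \<le> 4 * C * (2 * C * norm y)"
    using flat \<open>C \<ge> 0\<close> by (intro mult_left_mono) auto
  finally show ?thesis by (simp add: power2_eq_square)
qed

text \<open>The size condition on \<open>A\<close> and \<open>B\<close> passes to every subset of \<open>A\<close>, so the convexity
  principle applies.\<close>

lemma norm_combination_le_max_conservative:
  assumes mc: "\<And>A B. \<lbrakk>finite A; finite B; \<forall>a\<in>A. \<forall>b\<in>B. a < b;
        (lam - 1) * real (max_number A) + real (card A) \<le> real (card B)\<rbrakk>
      \<Longrightarrow> norm (\<Sum>n\<in>A. e n) \<le> D * norm (\<Sum>n\<in>B. e n)"
    and "lam \<ge> 1" and A: "finite A" and B: "finite B" and less: "\<forall>a\<in>A. \<forall>b\<in>B. a < b"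
    and card: "(lam - 1) * real (max_number A) + real (card A) \<le> real (card B)"
    and c: "0 \<le> a" "\<And>n. n \<in> A \<Longrightarrow> norm (c n) \<le> a"
  shows "norm (\<Sum>n\<in>A. scaleK (c n) (e n)) \<le> 4 * D * (a * norm (\<Sum>n\<in>B. e n))"
proof -
  have "norm (\<Sum>n\<in>A. scaleK (c n) (e n)) \<le> 4 * a * (D * norm (\<Sum>n\<in>B. e n))"
  proof (rule norm_combination_le_subset_sums)
    fix U assume U: "U \<subseteq> A"
    have "max_number U \<le> max_number A"
      unfolding max_number_def by (rule Max_mono) (use U A in auto)
    then have "(lam - 1) * real (max_number U) \<le> (lam - 1) * real (max_number A)"
      using \<open>lam \<ge> 1\<close> by (intro mult_left_mono) auto
    moreover have "real (card U) \<le> real (card A)" using card_mono[OF A U] by simp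
    ultimately show "norm (sum e U) \<le> D * norm (\<Sum>n\<in>B. e n)"
      using U A B less card finite_subset[OF U A] by (intro mc) auto
  qed (use A c in auto)
  then show ?thesis by (simp add: mult_ac)
qed

section \<open>Partially greedy bases\<close>

text \<open>The empty partial sum bounds the error of greedy sets of the sizes \<open>\<lceil>lam m\<rceil>\<close>. Consecutive
  such sizes have bounded gaps, so every greedy set exceeds one of them by boundedly many terms.\<close>

lemma quasi_greedy_if_partially_greedy:
  assumes "lam \<ge> 1" "partially_greedy lam scaleK e"
  shows "quasi_greedy scaleK e"
proof -
  obtain C where "C \<ge> 1" and C: "\<And>x m n L. \<lbrakk>n \<le> m; greedy x L; card L = nat \<lceil>lam * real m\<rceil>\<rbrakk>
      \<Longrightarrow> norm (x - P L x) \<le> C * norm (x - P {..<n} x)"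
    using assms(2) unfolding partially_greedy_iff by metis
  obtain K where "0 \<le> K" and K: "\<And>A x. finite A \<Longrightarrow> norm (P A x) \<le> card A * (K * norm x)"
    by (rule norm_proj_le_card) blast
  have "norm (x - P L x) \<le> (C + lam * K) * norm x" if L: "greedy x L" for x L
  proof -
    \<comment> \<open>The largest \<open>m\<close> for which a greedy set of size \<open>\<lceil>lam m\<rceil>\<close> fits into \<open>L\<close>.\<close>
    define m where "m = nat \<lfloor>real (card L) / lam\<rfloor>"
    have fin: "finite L" using L by (simp add: greedy_set_def)
    have "real m = of_int \<lfloor>real (card L) / lam\<rfloor>"
      using assms(1) by (simp add: m_def)
    then have m: "real m \<le> real (card L) / lam" "real (card L) / lam < real m + 1"
      by linarith+
    then have m': "lam * real m \<le> real (card L)" "real (card L) < lam * real m + lam"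
      using assms(1) by (simp_all add: field_simps)
    then have k: "nat \<lceil>lam * real m\<rceil> \<le> card L" by (simp add: ceiling_le_iff)
    then obtain L' where L': "L' \<subseteq> L" "greedy x L'" "card L' = nat \<lceil>lam * real m\<rceil>"
      using greedy_subset_of_card[OF L] by blast
    have "lam * real m \<le> real (card L')" unfolding L' by (rule real_nat_ceiling_ge)
    moreover have "card (L - L') + card L' = card L"
      using card_mono[OF fin L'(1)] L'(1) fin by (simp add: card_Diff_subset finite_subset)
    ultimately have "real (card (L - L')) \<le> lam" using m'(2) by linarith
    then have "norm (P (L - L') x) \<le> lam * (K * norm x)"
      using K[of "L - L'" x] fin \<open>0 \<le> K\<close>
      by (meson finite_Diff mult_right_mono mult_nonneg_nonneg norm_ge_zero order_trans)
    moreover have "norm (x - P L' x) \<le> C * norm x"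
      using C[OF _ L'(2,3), of 0] by (simp add: proj_def)
    moreover have "x - P L x = (x - P L' x) - P (L - L') x"
      using proj_diff[OF fin L'(1)] by simp
    ultimately show ?thesis
      using norm_triangle_ineq4[of "x - P L' x" "P (L - L') x"] by (simp add: algebra_simps)
  qed
  moreover have "C + lam * K \<ge> 1" using \<open>C \<ge> 1\<close> assms(1) \<open>0 \<le> K\<close> by (simp add: add_increasing2)
  ultimately show ?thesis unfolding quasi_greedy_iff by blast
qed

text \<open>Both \<open>1\<^sub>A\<close> and \<open>1\<^bsub>B'\<^esub>\<close> are remainders of the same vector, the first after a greedy
  projection and the second after a partial sum. The quasi-greedy property is used once more to
  pass from \<open>B'\<close> to \<open>B\<close>.\<close>

lemma max_conservative_if_partially_greedy:
  assumes "lam \<ge> 1" "partially_greedy lam scaleK e"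
  shows "max_conservative lam e"
proof -
  obtain C where "C \<ge> 1" and C: "\<And>x m n L. \<lbrakk>n \<le> m; greedy x L; card L = nat \<lceil>lam * real m\<rceil>\<rbrakk>
      \<Longrightarrow> norm (x - P L x) \<le> C * norm (x - P {..<n} x)"
    using assms(2) unfolding partially_greedy_iff by metis
  obtain Q where "Q \<ge> 1" and Q: "\<And>x L. greedy x L \<Longrightarrow> norm (x - P L x) \<le> Q * norm x"
    using quasi_greedy_if_partially_greedy[OF assms] unfolding quasi_greedy_iff by metis
  have "norm (\<Sum>n\<in>A. e n) \<le> C * Q * norm (\<Sum>n\<in>B. e n)"
    if A: "finite A" and B: "finite B" and less: "\<forall>a\<in>A. \<forall>b\<in>B. a < b"
      and card: "(lam - 1) * real (max_number A) + real (card A) \<le> real (card B)" for A B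
  proof (cases "A = {}")
    case True
    with \<open>C \<ge> 1\<close> \<open>Q \<ge> 1\<close> show ?thesis by simp
  next
    case False
    define m where "m = max_number A"
    have "m = Suc (Max A)"
      using A False by (simp add: m_def max_number_def mono_Max_commute[symmetric] mono_def)
    then have Am: "A \<subseteq> {..<m}" and Bm: "B \<inter> {..<m} = {}"
      using A bspec[OF less Max_in[OF A False]] by (force simp: less_Suc_eq_le)+
    define D where "D = {..<m} - A"
    have D: "finite D" "card D + card A = m"
      using Am A card_mono[OF _ Am] by (auto simp: D_def card_Diff_subset)
    have "real m \<le> lam * real m" using assms(1) by (simp add: mult_le_cancel_right1)
    then have k: "card D \<le> nat \<lceil>lam * real m\<rceil>"
      using D(2) real_nat_ceiling_ge[of "lam * real m"] by linarith
    \<comment> \<open>This is the size condition, rewritten: it provides enough indices for a greedy set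
      of \<open>\<lceil>lam m\<rceil>\<close> elements that avoids \<open>A\<close>.\<close>
    have "lam * real m \<le> real (card B + card D)"
      using card D(2) by (simp add: m_def[symmetric] algebra_simps flip: of_nat_add)
    then have "nat \<lceil>lam * real m\<rceil> - card D \<le> card B"
      by (simp add: ceiling_le_iff le_diff_conv)
    then obtain B' where B': "B' \<subseteq> B" "card B' = nat \<lceil>lam * real m\<rceil> - card D"
      by (meson obtain_subset_with_card_n)
    have fin': "finite B'" using B' B finite_subset by blast
    define x where "x = (\<Sum>n\<in>{..<m} \<union> B'. e n)"
    have disj: "B' \<inter> {..<m} = {}" using B' Bm by auto
    have DB: "D \<union> B' \<subseteq> {..<m} \<union> B'" by (auto simp: D_def)
    have "greedy x (D \<union> B')"
      using D(1) fin' by (auto simp: greedy_set_def x_def coord_sum_basis D_def)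
    moreover have "card (D \<union> B') = nat \<lceil>lam * real m\<rceil>"
      using k B' D(1) fin' disj by (subst card_Un_disjoint) (auto simp: D_def)
    ultimately have "norm (x - P (D \<union> B') x) \<le> C * norm (x - P {..<m} x)"
      using C by blast
    moreover have "x - P (D \<union> B') x = (\<Sum>n\<in>A. e n)"
    proof -
      have "P (D \<union> B') x = (\<Sum>n\<in>D \<union> B'. e n)"
        unfolding x_def by (rule proj_sum_basis) (use fin' DB in auto)
      moreover have "A = ({..<m} \<union> B') - (D \<union> B')" using Am disj by (auto simp: D_def)
      ultimately show ?thesis
        using DB fin' by (simp add: x_def sum_diff)
    qed
    moreover have "x - P {..<m} x = (\<Sum>n\<in>B'. e n)"
    proof -
      have "P {..<m} x = (\<Sum>n<m. e n)"
        unfolding x_def by (rule proj_sum_basis) (use fin' in auto)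
      then show ?thesis
        using fin' disj by (simp add: x_def sum.union_disjoint Int_commute)
    qed
    ultimately have "norm (\<Sum>n\<in>A. e n) \<le> C * norm (\<Sum>n\<in>B'. e n)" by simp
    also have "norm (\<Sum>n\<in>B'. e n) \<le> Q * norm (\<Sum>n\<in>B. e n)"
    proof -
      have "greedy (\<Sum>n\<in>B. e n) (B - B')"
        using B by (auto simp: greedy_set_def coord_sum_basis)
      from Q[OF this] show ?thesis
        using B B' by (simp add: proj_sum_basis sum_diff)
    qed
    finally show ?thesis using \<open>C \<ge> 1\<close> by (simp add: mult_left_mono)
  qed
  moreover have "C * Q > 0" using \<open>C \<ge> 1\<close> \<open>Q \<ge> 1\<close> by simp
  ultimately show ?thesis unfolding max_conservative_def by blast
qed

text \<open>A greedy set \<open>L\<close> of \<open>x\<close> can differ from an initial segment \<open>[n]\<close> in two ways. The indices in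
  \<open>L - [n]\<close> are a greedy choice for the remainder \<open>x - S\<^sub>n x\<close>; those in \<open>[n] - L\<close> are wrongly kept
  in the error, but their coordinates are dominated by all coordinates on the later set
  \<open>L - [n]\<close>, which is large enough for conservativity to apply.\<close>

lemma partially_greedy_if_quasi_greedy_max_conservative:
  assumes "lam \<ge> 1" "quasi_greedy scaleK e" "max_conservative lam e"
  shows "partially_greedy lam scaleK e"
proof -
  obtain C where "C \<ge> 1" and C: "\<And>x L. greedy x L \<Longrightarrow> norm (x - P L x) \<le> C * norm x"
    using assms(2) unfolding quasi_greedy_iff by metis
  obtain D where "D > 0" and D: "\<And>A B. \<lbrakk>finite A; finite B; \<forall>a\<in>A. \<forall>b\<in>B. a < b;
        (lam - 1) * real (max_number A) + real (card A) \<le> real (card B)\<rbrakk>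
      \<Longrightarrow> norm (\<Sum>n\<in>A. e n) \<le> D * norm (\<Sum>n\<in>B. e n)"
    using assms(3) unfolding max_conservative_def by metis
  have "norm (x - P L x) \<le> (C + 32 * D * C ^ 2) * norm (x - P {..<n} x)"
    if "n \<le> m" and L: "greedy x L" and card_L: "card L = nat \<lceil>lam * real m\<rceil>" for x m n L
  proof -
    define y where "y = x - P {..<n} x"
    define A where "A = {..<n} - L"
    define B where "B = L - {..<n}"
    have fin: "finite L" "finite A" "finite B"
      using L by (auto simp: greedy_set_def A_def B_def)
    have co_y: "co k y = (if k < n then 0 else co k x)" for k
      by (simp add: y_def coord_diff_proj)
    have greedy_B: "greedy y B"
      using L by (auto simp: greedy_set_def co_y B_def)
    have decomp: "x - P L x = (y - P B y) + P A x"
    proof -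
      have "P B y = P B x" by (rule proj_cong) (simp add: co_y B_def)
      also have "\<dots> = P L x - P (L \<inter> {..<n}) x"
        using proj_diff[OF fin(1), of "L \<inter> {..<n}" x] by (simp add: B_def Diff_Int)
      finally have B: "P B y = P L x - P (L \<inter> {..<n}) x" .
      have "P A x = P {..<n} x - P (L \<inter> {..<n}) x"
        using proj_diff[of "{..<n}" "L \<inter> {..<n}" x] by (simp add: A_def Diff_Int)
      with B show ?thesis by (simp add: y_def)
    qed
    have card: "(lam - 1) * real (max_number A) + real (card A) \<le> real (card B)"
    proof -
      have "max_number A \<le> n" by (auto simp: max_number_def fin A_def)
      then have "(lam - 1) * real (max_number A) \<le> (lam - 1) * real n"
        using assms(1) by (intro mult_left_mono) auto
      moreover have "lam * real n \<le> real (card L)"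
      proof -
        have "lam * real n \<le> lam * real m" using assms(1) \<open>n \<le> m\<close> by simp
        also have "\<dots> \<le> real (card L)" unfolding card_L by (rule real_nat_ceiling_ge)
        finally show ?thesis .
      qed
      moreover have "card A + card (L \<inter> {..<n}) = n"
        using card_Int_Diff[of "{..<n}" L] by (simp add: A_def Int_commute)
      moreover have "card B + card (L \<inter> {..<n}) = card L"
        using card_Int_Diff[of L "{..<n}"] fin by (simp add: B_def)
      ultimately show ?thesis by (simp add: algebra_simps)
    qed
    have "norm (P A x) \<le> 32 * D * C ^ 2 * norm y"
    proof (cases "B = {}")
      case True
      \<comment> \<open>The size condition then leaves no room for indices in \<open>A\<close>.\<close>
      have "0 \<le> (lam - 1) * real (max_number A)" using assms(1) by simp
      with card True have "card A = 0" by simp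
      with fin have "A = {}" by simp
      with \<open>D > 0\<close> show ?thesis by (simp add: proj_def)
    next
      case False
      define a where "a = Min ((\<lambda>k. norm (co k x)) ` B)"
      have a_le: "a \<le> norm (co k x)" if "k \<in> B" for k
        using that fin by (simp add: a_def)
      have "a \<in> (\<lambda>k. norm (co k x)) ` B"
        unfolding a_def by (rule Min_in) (use fin False in auto)
      then obtain b where b: "b \<in> B" "a = norm (co b x)" by blast
      have "norm (P A x) \<le> 4 * D * (a * norm (\<Sum>k\<in>B. e k))"
        unfolding proj_def
      proof (rule norm_combination_le_max_conservative[OF D assms(1) fin(2,3) _ card])
        show "norm (co k x) \<le> a" if "k \<in> A" for k
          using that b L by (auto simp: greedy_set_def A_def B_def)
      qed (use b in \<open>auto simp: A_def B_def\<close>)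
      also have "a * norm (\<Sum>k\<in>B. e k) \<le> 8 * C ^ 2 * norm y"
        by (rule norm_sum_basis_le_quasi_greedy[OF C _ greedy_B])
          (use \<open>C \<ge> 1\<close> a_le b in \<open>auto simp: co_y B_def\<close>)
      finally show ?thesis using \<open>D > 0\<close> by (simp add: mult_ac)
    qed
    moreover have "norm (y - P B y) \<le> C * norm y" by (rule C[OF greedy_B])
    ultimately show ?thesis
      using norm_triangle_ineq[of "y - P B y" "P A x"]
      by (simp add: decomp algebra_simps flip: y_def)
  qed
  moreover have "C + 32 * D * C ^ 2 \<ge> 1" using \<open>C \<ge> 1\<close> \<open>D > 0\<close> by (simp add: add_increasing2)
  ultimately show ?thesis unfolding partially_greedy_iff by blast
qed

end

theorem theorem1p7:
  fixes lam :: real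
    and scaleK :: "'k::real_or_complex \<Rightarrow> 'a::banach \<Rightarrow> 'a"
    and e :: "nat \<Rightarrow> 'a"
  assumes "banach_space_over scaleK"
    and "infinite_dimensional scaleK"
    and "is_basis scaleK e"
    and "lam \<ge> 1"
  shows "partially_greedy lam scaleK e \<longleftrightarrow> quasi_greedy scaleK e \<and> max_conservative lam e"
proof -
  interpret banach_basis scaleK e
    using assms(1,3) by (simp add: banach_basis_def banach_basis_axioms_def)
  show ?thesis
    using quasi_greedy_if_partially_greedy max_conservative_if_partially_greedy
      partially_greedy_if_quasi_greedy_max_conservative assms(4) by blast
qed

end
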